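(* Every finitely presented group admitting an epimorphism onto the Basilica group $\mathfrak B$ is large (in particular contains non-abelian free subgroups).
   Context: Let $X=\{0,1\}$ and $X^*$ the binary rooted tree of finite words. The Basilica group $\mathfrak B$ is the group of automorphisms of $X^*$ generated by $a,b$ defined recursively by $a(0w)=1\,b(w)$, $a(1w)=0w$, $b(0w)=0\,a(w)$, $b(1w)=1w$ (i.e. $a=(b,1)\tau$, $b=(a,1)$ with $\tau$ the swap of the first letter). A group is large if it has a finite-index subgroup admitting an epimorphism onto a non-abelian free group. *)

theory Defs
  imports "HOL-Algebra.Algebra"
begin

text \<open>Binary words: letter 0 is False, letter 1 is True.
  a(0w) = 1 b(w), a(1w) = 0 w, b(0w) = 0 a(w), b(1w) = 1 w, and both fix the empty word.\<close>

fun basA :: "bool list \<Rightarrow> bool list" and basB :: "bool list \<Rightarrow> bool list" where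
  "basA [] = []"
| "basA (False # w) = True # basB w"
| "basA (True # w) = False # w"
| "basB [] = []"
| "basB (False # w) = False # basA w"
| "basB (True # w) = True # w"

definition basilica :: "(bool list \<Rightarrow> bool list) monoid" where
  "basilica = (BijGroup (UNIV :: bool list set))
     \<lparr>carrier := generate (BijGroup (UNIV :: bool list set)) {basA, basB}\<rparr>"

text \<open>Words over an alphabet: letters are (generator, sign), sign True meaning the generator
  itself and False its formal inverse.\<close>

type_synonym 'a gword = "('a \<times> bool) list"

definition letter_inv :: "'a \<times> bool \<Rightarrow> 'a \<times> bool" where
  "letter_inv x = (fst x, \<not> snd x)"

inductive pstep :: "'a set \<Rightarrow> 'a gword set \<Rightarrow> 'a gword \<Rightarrow> 'a gword \<Rightarrow> bool"
  for A R where
  cancel: "fst x \<in> A \<Longrightarrow> pstep A R (u @ v) (u @ [x, letter_inv x] @ v)"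
| relator: "r \<in> R \<Longrightarrow> pstep A R (u @ v) (u @ r @ v)"

definition pequiv :: "'a set \<Rightarrow> 'a gword set \<Rightarrow> 'a gword \<Rightarrow> 'a gword \<Rightarrow> bool" where
  "pequiv A R = (\<lambda>u v. pstep A R u v \<or> pstep A R v u)\<^sup>*\<^sup>*"

definition pclass :: "'a set \<Rightarrow> 'a gword set \<Rightarrow> 'a gword \<Rightarrow> 'a gword set" where
  "pclass A R w = {v \<in> lists (A \<times> UNIV). pequiv A R w v}"

definition pres_group :: "'a set \<Rightarrow> 'a gword set \<Rightarrow> 'a gword set monoid" where
  "pres_group A R =
     \<lparr>carrier = pclass A R ` lists (A \<times> UNIV),
      monoid.mult = (\<lambda>c d. pclass A R ((SOME u. u \<in> c) @ (SOME v. v \<in> d))),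
      monoid.one = pclass A R []\<rparr>"

definition free_group :: "'a set \<Rightarrow> 'a gword set monoid" where
  "free_group A = pres_group A {}"

definition finitely_presented :: "('g, 'm) monoid_scheme \<Rightarrow> bool" where
  "finitely_presented G \<longleftrightarrow>
     (\<exists>(A :: nat set) R. finite A \<and> finite R \<and> R \<subseteq> lists (A \<times> UNIV) \<and> G \<cong> pres_group A R)"

definition large :: "('g, 'm) monoid_scheme \<Rightarrow> bool" where
  "large G \<longleftrightarrow>
     (\<exists>H. subgroup H G \<and> finite (rcosets\<^bsub>G\<^esub> H) \<and>
        (\<exists>(A :: nat set) f. (\<exists>x\<in>A. \<exists>y\<in>A. x \<noteq> y) \<and>
           f \<in> hom (G\<lparr>carrier := H\<rparr>) (free_group A) \<and>
           f ` H = carrier (free_group A)))"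

end

theory Submission
  imports Defs
begin

text \<open>The wreath recursion of the Basilica group lifts to the free group \<open>F\<close> on \<open>a, b\<close>. It is
  contracting there: a reduced word that acts trivially on the tree has shorter sections after at
  most two levels, so all its sections on some level are trivial in \<open>F\<close>. Hence finitely many
  words acting trivially have freely trivial sections on a common level \<open>n\<close>. Lift the generators
  of a finitely presented cover \<open>G\<close> to words in \<open>a, b\<close>, and choose \<open>n\<close> for the images of the
  relators together with the words expressing that \<open>a\<close> and \<open>b\<close> are hit. Then \<open>G\<close> maps onto
  \<open>F / K\<^sub>n\<close>, where \<open>K\<^sub>n\<close> consists of the words that fix level \<open>n\<close> and have trivial sections
  there. The stabilizer of the vertex \<open>0\<^sup>n\<close> has finite index, and taking the section at \<open>0\<^sup>n\<close>
  maps it onto \<open>F\<close>, because \<open>b\<close> has section \<open>a\<close> and \<open>a\<^sup>2\<close> has section \<open>b\<close> at \<open>0\<close>.\<close>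

section \<open>Presented groups\<close>

lemma pequiv_refl [simp]: "pequiv A R u u"
  by (simp add: pequiv_def)

lemma pequiv_trans [trans]: "pequiv A R u v \<Longrightarrow> pequiv A R v w \<Longrightarrow> pequiv A R u w"
  unfolding pequiv_def by (rule rtranclp_trans)

lemma pequiv_sym: "pequiv A R u v \<Longrightarrow> pequiv A R v u"
  unfolding pequiv_def by (rule sympD[OF symp_rtranclp]) (auto intro: sympI)

lemma pstep_pequiv: "pstep A R u v \<Longrightarrow> pequiv A R u v"
  unfolding pequiv_def by blast

text \<open>Reduces invariance of a map on words to a single insertion step; used with
  \<open>E\<close> equal to \<open>pequiv\<close> and to \<open>level_eq\<close>.\<close>

lemma pequiv_mapI:
  assumes "pequiv A R u v"
    and "\<And>u. E (F u) (F u)"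
    and "\<And>u v. E u v \<Longrightarrow> E v u"
    and "\<And>u v w. E u v \<Longrightarrow> E v w \<Longrightarrow> E u w"
    and "\<And>u v. pstep A R u v \<Longrightarrow> E (F u) (F v)"
  shows "E (F u) (F v)"
  using assms(1) unfolding pequiv_def
  by (induction rule: rtranclp_induct) (use assms(2-) in blast)+

lemma pstep_context: "pstep A R u v \<Longrightarrow> pstep A R (p @ u @ q) (p @ v @ q)"
proof (induction rule: pstep.induct)
  case (cancel x u v)
  then show ?case using pstep.cancel[of x A R "p @ u" "v @ q"] by simp
next
  case (relator r u v)
  then show ?case using pstep.relator[of r R A "p @ u" "v @ q"] by simp
qed

lemma pequiv_context:
  assumes "pequiv A R u v" shows "pequiv A R (p @ u @ q) (p @ v @ q)"
  using assms
  by (rule pequiv_mapI[where F = "\<lambda>u. p @ u @ q"])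
     (auto intro: pequiv_sym pequiv_trans pstep_pequiv pstep_context)

lemma pequiv_append:
  assumes "pequiv A R u u'" "pequiv A R v v'"
  shows "pequiv A R (u @ v) (u' @ v')"
  using pequiv_context[OF assms(1), of "[]" v] pequiv_context[OF assms(2), of u' "[]"]
  by (auto intro: pequiv_trans)

text \<open>Used to pass from words over \<open>bgen\<close> to words over numbers, since
  \<open>large\<close> asks for a free group on a set of naturals.\<close>

lemma pequiv_map_generators:
  assumes "pequiv A {} u v" "c ` A \<subseteq> B"
  shows "pequiv B {} (map (apfst c) u) (map (apfst c) v)"
  using assms(1)
proof (rule pequiv_mapI[where F = "map (apfst c)"])
  fix u v assume "pstep A {} u v"
  then show "pequiv B {} (map (apfst c) u) (map (apfst c) v)"
  proof cases
    case (cancel x u' v')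
    then have "pstep B {} (map (apfst c) u' @ map (apfst c) v')
        (map (apfst c) u' @ [apfst c x, letter_inv (apfst c x)] @ map (apfst c) v')"
      using assms(2) by (intro pstep.cancel) (auto simp: apfst_def map_prod_def split: prod.splits)
    then show ?thesis
      using cancel by (auto intro!: pstep_pequiv simp: letter_inv_def apfst_def map_prod_def split: prod.splits)
  qed auto
qed (auto intro: pequiv_sym pequiv_trans)

lemma pclass_eqI: "pequiv A R u v \<Longrightarrow> pclass A R u = pclass A R v"
  unfolding pclass_def by (auto intro: pequiv_trans pequiv_sym)

lemma pclass_eqD:
  "pclass A R u = pclass A R v \<Longrightarrow> v \<in> lists (A \<times> UNIV) \<Longrightarrow> pequiv A R u v"
  unfolding pclass_def by auto

lemma pres_group_carrier: "carrier (pres_group A R) = pclass A R ` lists (A \<times> UNIV)"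
  by (simp add: pres_group_def)

text \<open>Multiplication in \<open>pres_group\<close> picks representatives by
  \<open>SOME\<close>. The class of a word over \<open>A\<close> contains that word, so the choice
  is harmless.\<close>

lemma pequiv_some_pclass:
  assumes "u \<in> lists (A \<times> UNIV)"
  shows "pequiv A R u (SOME v. v \<in> pclass A R u)"
proof -
  have "u \<in> pclass A R u" using assms by (simp add: pclass_def)
  then have "(SOME v. v \<in> pclass A R u) \<in> pclass A R u" by (rule someI)
  then show ?thesis by (simp add: pclass_def)
qed

lemma pres_group_mult:
  assumes "u \<in> lists (A \<times> UNIV)" "v \<in> lists (A \<times> UNIV)"
  shows "pclass A R u \<otimes>\<^bsub>pres_group A R\<^esub> pclass A R v = pclass A R (u @ v)"
  using pclass_eqI[OF pequiv_append[OF pequiv_some_pclass[OF assms(1)] pequiv_some_pclass[OF assms(2)]]]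
  by (simp add: pres_group_def)

section \<open>The wreath recursion on words in the generators\<close>

datatype bgen = Ga | Gb

type_synonym bword = "bgen gword"

text \<open>As in \<open>BijGroup\<close>, the last letter of a word acts first.\<close>

fun lperm :: "bgen \<times> bool \<Rightarrow> bool \<Rightarrow> bool" where
  "lperm (Ga, s) x = (\<not> x)"
| "lperm (Gb, s) x = x"

text \<open>The test \<open>s \<noteq> x\<close> joins two cases: \<open>a\<close> has section
  \<open>b\<close> at 0, and the inverse of \<open>a\<close> has as section the inverse of
  \<open>b\<close> at 1.\<close>

fun lsec :: "bgen \<times> bool \<Rightarrow> bool \<Rightarrow> bword" where
  "lsec (Ga, s) x = (if s \<noteq> x then [(Gb, s)] else [])"
| "lsec (Gb, s) x = (if x then [] else [(Ga, s)])"

primrec wperm :: "bword \<Rightarrow> bool \<Rightarrow> bool" where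
  "wperm [] x = x"
| "wperm (l # w) x = lperm l (wperm w x)"

primrec wsec :: "bword \<Rightarrow> bool \<Rightarrow> bword" where
  "wsec [] x = []"
| "wsec (l # w) x = lsec l (wperm w x) @ wsec w x"

fun weval :: "bword \<Rightarrow> bool list \<Rightarrow> bool list" where
  "weval w [] = []"
| "weval w (x # v) = wperm w x # weval (wsec w x) v"

fun wsecs :: "bword \<Rightarrow> bool list \<Rightarrow> bword" where
  "wsecs w [] = w"
| "wsecs w (x # v) = wsecs (wsec w x) v"

lemma wperm_append: "wperm (u @ v) x = wperm u (wperm v x)"
  by (induction u) auto

lemma wsec_append: "wsec (u @ v) x = wsec u (wperm v x) @ wsec v x"
  by (induction u) (auto simp: wperm_append)

lemma weval_append: "weval (u @ v) x = weval u (weval v x)"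
  by (induction x arbitrary: u v) (auto simp: wperm_append wsec_append)

lemma weval_Nil [simp]: "weval [] = id"
proof
  show "weval [] x = id x" for x by (induction x) auto
qed

lemma weval_Cons: "weval (l # w) x = weval [l] (weval w x)"
  using weval_append[of "[l]" w] by simp

lemma length_weval [simp]: "length (weval w x) = length x"
  by (induction x arbitrary: w) auto

lemma wsecs_append: "wsecs (u @ v) x = wsecs u (weval v x) @ wsecs v x"
  by (induction x arbitrary: u v) (auto simp: wsec_append)

lemma letter_inv_invol [simp]: "letter_inv (letter_inv l) = l"
  by (simp add: letter_inv_def)

lemma wperm_cancel [simp]: "lperm l (lperm (letter_inv l) x) = x"
  by (cases "(l, x)" rule: lperm.cases) (auto simp: letter_inv_def)

text \<open>Sections inherit cancellation. Hence cancelling pairs act trivially on all levels, and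
  sections are well defined on the free group.\<close>

lemma wsec_cancel:
  "wsec [l, letter_inv l] x = [] \<or> (\<exists>k. wsec [l, letter_inv l] x = [k, letter_inv k])"
  by (cases "(l, x)" rule: lperm.cases) (auto simp: letter_inv_def)

lemma weval_cancel: "weval [l, letter_inv l] = id"
proof
  show "weval [l, letter_inv l] x = id x" for x
  proof (induction x arbitrary: l)
    case (Cons z x)
    show ?case
      using wsec_cancel[of l z] Cons.IH by (auto simp del: wsec.simps)
  qed simp
qed

lemma weval_gens: "weval [(Ga, True)] x = basA x \<and> weval [(Gb, True)] x = basB x"
proof (induction x)
  case (Cons z x)
  then show ?case by (cases z) auto
qed simp

text \<open>Signed letters already provide the inverses of the generators, so the values of words
  form the whole generated subgroup.\<close>

lemma carrier_basilica: "carrier basilica = range weval"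
  and basilica_mult: "f \<in> range weval \<Longrightarrow> g \<in> range weval \<Longrightarrow> f \<otimes>\<^bsub>basilica\<^esub> g = f \<circ> g"
proof -
  let ?S = "BijGroup (UNIV :: bool list set)"
  interpret S: group ?S by (rule group_BijGroup)
  have A: "weval [(Ga, True)] = basA" and B: "weval [(Gb, True)] = basB"
    using weval_gens by auto
  have bij1: "bij (weval [l])" for l
  proof (rule o_bij)
    show "weval [letter_inv l] \<circ> weval [l] = id" "weval [l] \<circ> weval [letter_inv l] = id"
      using weval_cancel[of l] weval_cancel[of "letter_inv l"]
      by (auto simp: fun_eq_iff simp flip: weval_append)
  qed
  have bij: "bij (weval w)" for w
  proof (induction w)
    case (Cons l w)
    then show ?case using bij_comp[OF Cons bij1[of l]]
      by (simp add: comp_def flip: weval_Cons)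
  qed (metis weval_Nil bij_id)
  have S: "carrier ?S = {f. bij f}"
    by (auto simp: BijGroup_def Bij_def)
  have mult: "f \<otimes>\<^bsub>?S\<^esub> g = f \<circ> g" if "bij f" "bij g" for f g
    using that by (auto simp: BijGroup_def Bij_def compose_def)
  have one: "\<one>\<^bsub>?S\<^esub> = id"
    by (auto simp: BijGroup_def)
  have inv: "inv\<^bsub>?S\<^esub> (weval [l]) = weval [letter_inv l]" for l
  proof (rule S.inv_equality)
    show "weval [letter_inv l] \<otimes>\<^bsub>?S\<^esub> weval [l] = \<one>\<^bsub>?S\<^esub>"
      using weval_cancel[of "letter_inv l"]
      by (auto simp: mult bij one fun_eq_iff simp flip: weval_append)
  qed (auto simp: S bij)
  have "f \<in> range weval" if "f \<in> generate ?S {basA, basB}" for f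
    using that
  proof induction
    case one
    then show ?case using \<open>\<one>\<^bsub>?S\<^esub> = id\<close> weval_Nil by (metis rangeI)
  next
    case (incl f)
    then show ?case using A B by (metis insertE rangeI singletonD)
  next
    case (inv f)
    then show ?case using A B \<open>\<And>l. inv\<^bsub>?S\<^esub> (weval [l]) = weval [letter_inv l]\<close>
      by (metis insertE rangeI singletonD)
  next
    case (eng f g)
    then obtain u v where "f = weval u" "g = weval v" by auto
    then have "f \<otimes>\<^bsub>?S\<^esub> g = weval (u @ v)" by (auto simp: mult bij weval_append)
    then show ?case by simp
  qed
  moreover have "weval w \<in> generate ?S {basA, basB}" for w
  proof (induction w)
    case Nil
    then show ?case using generate.one[of ?S] one by (metis weval_Nil)
  next
    case (Cons l w)
    obtain g s where l: "l = (g, s)" by (cases l)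
    have pos: "weval [(g, True)] \<in> {basA, basB}" using A B by (cases g) auto
    have "weval [l] \<in> generate ?S {basA, basB}"
    proof (cases s)
      case True
      then show ?thesis using pos l by (auto intro: generate.incl)
    next
      case False
      then show ?thesis
        using generate.inv[OF pos, of ?S] l by (simp add: inv letter_inv_def)
    qed
    from generate.eng[OF this Cons] show ?case
      by (simp add: mult bij comp_def flip: weval_Cons)
  qed
  ultimately have "generate ?S {basA, basB} = range weval" by blast
  then show "carrier basilica = range weval" by (simp add: basilica_def)
  show "f \<otimes>\<^bsub>basilica\<^esub> g = f \<circ> g" if "f \<in> range weval" "g \<in> range weval"
  proof -
    have "bij f" "bij g" using that bij by auto
    then show ?thesis using mult by (simp add: basilica_def)
  qed
qed

section \<open>Equality of words up to sections at a given level\<close>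

abbreviation fequiv :: "bword \<Rightarrow> bword \<Rightarrow> bool" where
  "fequiv \<equiv> pequiv UNIV {}"

text \<open>For \<open>v = []\<close> this is membership of \<open>u\<close> in
  \<open>K\<^sub>n\<close>. A congruence on words replaces the quotient
  \<open>F / K\<^sub>n\<close>.\<close>

primrec level_eq :: "nat \<Rightarrow> bword \<Rightarrow> bword \<Rightarrow> bool" where
  "level_eq 0 u v = fequiv u v"
| "level_eq (Suc n) u v = (\<forall>x. wperm u x = wperm v x \<and> level_eq n (wsec u x) (wsec v x))"

lemma level_eq_refl [simp]: "level_eq n u u"
  by (induction n arbitrary: u) auto

lemma level_eq_sym: "level_eq n u v \<Longrightarrow> level_eq n v u"
  by (induction n arbitrary: u v) (auto intro: pequiv_sym)

lemma level_eq_trans [trans]: "level_eq n u v \<Longrightarrow> level_eq n v w \<Longrightarrow> level_eq n u w"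
proof (induction n arbitrary: u v w)
  case (Suc n)
  have "level_eq n (wsec u x) (wsec w x)" for x
    using Suc.prems by (intro Suc.IH[of "wsec u x" "wsec v x" "wsec w x"]) auto
  then show ?case using Suc.prems by simp
qed (auto intro: pequiv_trans)

lemma level_eq_append:
  "level_eq n u u' \<Longrightarrow> level_eq n v v' \<Longrightarrow> level_eq n (u @ v) (u' @ v')"
  by (induction n arbitrary: u v u' v') (auto intro: pequiv_append simp: wperm_append wsec_append)

lemma fequiv_cancel: "fequiv (u @ [l, letter_inv l] @ v) (u @ v)"
  by (rule pequiv_sym, rule pstep_pequiv, rule pstep.cancel) simp

text \<open>The wreath recursion descends to \<open>F\<close>: by \<open>wsec_cancel\<close>,
  inserting a cancelling pair inserts at most one cancelling pair into each section.\<close>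

lemma fequiv_level_1: "fequiv u v \<Longrightarrow> level_eq 1 u v"
proof (erule pequiv_mapI[where F = "\<lambda>u. u"])
  fix u v :: bword assume "pstep UNIV {} u v"
  then show "level_eq 1 u v"
  proof cases
    case (cancel l p q)
    have "fequiv (wsec u x) (wsec v x)" for x
    proof -
      let ?y = "wperm q x"
      have *: "wsec v x = wsec p ?y @ wsec [l, letter_inv l] ?y @ wsec q x"
        unfolding cancel wsec_append wperm_append by simp
      show ?thesis unfolding *
        using wsec_cancel[of l ?y] fequiv_cancel[of "wsec p ?y" _ "wsec q x"] cancel
        by (auto simp del: wsec.simps simp: wsec_append intro: pequiv_sym)
    qed
    then show ?thesis using cancel by (simp add: wperm_append)
  qed auto
qed (rule level_eq_refl, erule level_eq_sym, erule level_eq_trans, assumption)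

text \<open>The subgroups \<open>K\<^sub>n\<close> increase with \<open>n\<close>, which allows
  passing to a common level. All of the content is in the step from 0 to 1.\<close>

lemma level_eq_Suc: "level_eq n u v \<Longrightarrow> level_eq (Suc n) u v"
proof (induction n arbitrary: u v)
  case 0
  then show ?case using fequiv_level_1 by simp
qed simp

lemma level_eq_mono:
  assumes "level_eq n u v" "n \<le> m"
  shows "level_eq m u v"
  using assms(2,1) by (induction m rule: dec_induct) (auto intro: level_eq_Suc simp del: level_eq.simps)

lemma fequiv_level_eq: "fequiv u v \<Longrightarrow> level_eq n u v"
  using level_eq_mono[of 0 u v n] by simp

lemma level_eq_weval: "level_eq (length x) u v \<Longrightarrow> weval u x = weval v x"
  by (induction x arbitrary: u v) auto

lemma level_eq_wsecs: "level_eq (length x) u v \<Longrightarrow> fequiv (wsecs u x) (wsecs v x)"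
  by (induction x arbitrary: u v) auto

text \<open>\<open>contraction\<close> speaks of trivial words only; this turns its output back into
  an equation with a generator.\<close>

lemma level_eq_cancel_right:
  assumes "level_eq n (u @ [letter_inv l]) []"
  shows "level_eq n u [l]"
proof -
  have "level_eq n u (u @ [letter_inv l, l])"
    using fequiv_level_eq[OF fequiv_cancel[of u "letter_inv l" "[]"]] by (simp add: level_eq_sym)
  also have "level_eq n (u @ [letter_inv l, l]) [l]"
    using level_eq_append[OF assms level_eq_refl[of n "[l]"]] by simp
  finally show ?thesis .
qed

section \<open>Contraction\<close>

definition reduced :: "bword \<Rightarrow> bool" where
  "reduced w \<longleftrightarrow> (\<nexists>u l v. w = u @ [l, letter_inv l] @ v)"

lemma reduced_appendD: "reduced (u @ v) \<Longrightarrow> reduced u \<and> reduced v"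
  unfolding reduced_def by (metis append.assoc)

text \<open>A reduced word of this kind is a power of \<open>g\<close>.\<close>

definition gen_only :: "bgen \<Rightarrow> bword \<Rightarrow> bool" where
  "gen_only g w \<longleftrightarrow> (\<forall>l \<in> set w. fst l = g)"

lemma length_lsec: "length (lsec l x) \<le> 1"
  by (cases "(l, x)" rule: lsec.cases) auto

text \<open>Each letter has a nonempty section at only one of the two points, so it contributes to
  at most one of the two sections.\<close>

lemma length_wsec_sum: "length (wsec w False) + length (wsec w True) \<le> length w"
proof (induction w)
  case (Cons l w)
  \<comment> \<open>The two points stay distinct, so the letter \<open>l\<close> is read once at
    each of them.\<close>
  have "wperm w False \<noteq> wperm w True"
  proof (induction w)
    case (Cons l w)
    then show ?case by (cases "(l, True)" rule: lperm.cases) auto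
  qed simp
  then have "length (lsec l (wperm w False)) + length (lsec l (wperm w True)) \<le> 1"
    by (cases "(l, True)" rule: lperm.cases) auto
  with Cons show ?case by simp
qed simp

lemma length_wsec: "length (wsec w x) \<le> length w"
  using length_wsec_sum[of w] by (cases x) auto

lemma length_wsec_Cons_full:
  "length (wsec (l # w) x) = length (l # w) \<Longrightarrow>
    length (wsec w x) = length w \<and> length (lsec l (wperm w x)) = 1"
  using length_wsec[of w x] length_lsec[of l "wperm w x"] by auto

text \<open>Follow the point 0 through the letters, the last one first; each must have a nonempty
  section. At 0 these are the letters of \<open>Gb\<close>, which stay at 0, and
  \<open>(Ga, True)\<close>, which leads to 1.\<close>

lemma wsec_full_False:
  assumes "reduced w" "length (wsec w False) = length w"
  shows "(wperm w False \<longrightarrow> (\<exists>u. w = (Ga, True) # u \<and> gen_only Gb u)) \<and>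
    (\<not> wperm w False \<longrightarrow> gen_only Gb w)"
  using assms
proof (induction w)
  case (Cons l w)
  obtain g s where l: "l = (g, s)" by (cases l)
  have full: "length (wsec w False) = length w" "length (lsec l (wperm w False)) = 1"
    using length_wsec_Cons_full[OF Cons.prems(2)] by auto
  have red: "reduced w" using reduced_appendD[of "[l]" w] Cons.prems(1) by simp
  note IH = Cons.IH[OF red full(1)]
  show ?case
  proof (cases "wperm w False")
    case True
    then obtain u where u: "w = (Ga, True) # u" using IH by auto
    \<comment> \<open>At 1 only the inverse of \<open>a\<close> has a nonempty section, and it
      cancels the \<open>a\<close> that led there.\<close>
    have "l = (Ga, False)" using full(2) True l by (cases g) (auto split: if_splits)
    then have "l # w = [] @ [l, letter_inv l] @ u" using u by (simp add: letter_inv_def)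
    then show ?thesis using Cons.prems(1) unfolding reduced_def by blast
  next
    case False
    then show ?thesis using IH full(2) l
      by (cases g) (auto simp: gen_only_def split: if_splits)
  qed
qed (simp add: gen_only_def)

text \<open>A start at 1 forces the inverse of \<open>a\<close> as last letter, which leads to 0.
  The rest falls under \<open>wsec_full_False\<close> and has to return to 1.\<close>

lemma wsec_full:
  assumes "reduced w" "length (wsec w x) = length w" "wperm w x = x"
  shows "gen_only Gb w \<or>
    (\<exists>u. u \<noteq> [] \<and> gen_only Gb u \<and> w = [(Ga, True)] @ u @ [(Ga, False)])"
proof (cases x)
  case False
  then show ?thesis using wsec_full_False[of w] assms by simp
next
  case True
  show ?thesis
  proof (cases w rule: rev_cases)
    case Nil
    then show ?thesis by (simp add: gen_only_def)
  next
    case (snoc v l)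
    obtain g s where l: "l = (g, s)" by (cases l)
    have full: "length (wsec v (lperm l True)) + length (lsec l True) = length v + 1"
      using assms(2) snoc True by (simp add: wsec_append)
    have "length (lsec l True) = 1"
      using full length_lsec[of l True] length_wsec[of v "lperm l True"] by linarith
    then have l': "l = (Ga, False)" using l by (cases g) (auto split: if_splits)
    then have "length (wsec v False) = length v" "wperm v False"
      using full assms(3) True snoc by (auto simp: wperm_append)
    moreover have "reduced v" using reduced_appendD assms(1) snoc by blast
    ultimately obtain u where u: "v = (Ga, True) # u" "gen_only Gb u"
      using wsec_full_False[of v] by auto
    have "u \<noteq> []"
    proof
      assume "u = []"
      then have "w = [] @ [(Ga, True), letter_inv (Ga, True)] @ []"
        using u snoc l' by (simp add: letter_inv_def)
      then show False using assms(1) unfolding reduced_def by blast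
    qed
    then show ?thesis using u snoc l' by auto
  qed
qed

lemma wperm_gen_only_Gb: "gen_only Gb w \<Longrightarrow> wperm w x = x"
  by (induction w) (auto simp: gen_only_def)

lemma wsec_gen_only_Gb:
  "gen_only Gb w \<Longrightarrow> gen_only Ga (wsec w x) \<and> (length (wsec w x) = (if x then 0 else length w))"
proof (induction w)
  case (Cons l w)
  then have w: "gen_only Gb w" by (simp add: gen_only_def)
  obtain s where "l = (Gb, s)" using Cons.prems by (cases l) (auto simp: gen_only_def)
  then show ?case using Cons.IH[OF w] wperm_gen_only_Gb[OF w, of x]
    by (auto simp: gen_only_def)
qed (simp add: gen_only_def)

lemma not_gen_only: "w \<noteq> [] \<Longrightarrow> gen_only Ga w \<Longrightarrow> \<not> gen_only Gb w"
  by (cases w) (auto simp: gen_only_def)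

text \<open>The full-length section of a word as in \<open>wsec_full\<close> is \<open>a\<^sup>k\<close> or \<open>b a\<^sup>k b\<^sup>-\<^sup>1\<close> with \<open>k \<noteq> 0\<close>, which
  is not of the shape required there.\<close>

lemma wsec_full_twice:
  assumes "w \<noteq> []" "reduced w" "length (wsec w x) = length w" "wperm w x = x"
    and "reduced (wsec w x)" "wperm (wsec w x) y = y"
  shows "length (wsec (wsec w x) y) < length w"
proof (rule ccontr)
  let ?v = "wsec w x"
  assume "\<not> ?thesis"
  then have full: "length (wsec ?v y) = length ?v"
    using length_wsec[of ?v y] assms(3) by simp
  note V = wsec_full[OF assms(5) full assms(6)]
  from wsec_full[OF assms(2-4)] show False
  proof
    assume "gen_only Gb w"
    then have "gen_only Ga ?v" "?v \<noteq> []"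
      using wsec_gen_only_Gb[of w x] assms(1,3) by auto
    moreover from this obtain u where "u \<noteq> []" "gen_only Gb u" "?v = [(Ga, True)] @ u @ [(Ga, False)]"
      using V not_gen_only by blast
    ultimately show False using not_gen_only[of u] by (simp add: gen_only_def)
  next
    assume "\<exists>u. u \<noteq> [] \<and> gen_only Gb u \<and> w = [(Ga, True)] @ u @ [(Ga, False)]"
    then obtain u where u: "u \<noteq> []" "gen_only Gb u" "w = [(Ga, True)] @ u @ [(Ga, False)]"
      by blast
    have v: "?v = lsec (Ga, True) (\<not> x) @ wsec u (\<not> x) @ lsec (Ga, False) x"
      using u by (simp add: wsec_append wperm_append wperm_gen_only_Gb)
    \<comment> \<open>At 0 the block \<open>u\<close> would be read at 1, and all three factors of
      the section would be empty.\<close>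
    have x: "x" using assms(3) u wsec_gen_only_Gb[of u "\<not> x"] unfolding v
      by (cases x) auto
    then have "?v = [(Gb, True)] @ wsec u False @ [(Gb, False)]"
      using v by simp
    moreover have "gen_only Ga (wsec u False)" "wsec u False \<noteq> []"
      using wsec_gen_only_Gb[OF u(2), of False] u(1) by auto
    ultimately show False using V not_gen_only[of "wsec u False"]
      by (auto simp: gen_only_def)
  qed
qed

lemma weval_id_wsec:
  assumes "weval w = id"
  shows "wperm w x = x" "weval (wsec w x) = id"
proof -
  have "weval w (x # v) = x # v" for v using assms by simp
  then show "wperm w x = x" "weval (wsec w x) = id" by (auto simp: fun_eq_iff)
qed

text \<open>The two sections may become trivial on different levels; by monotonicity the larger
  level serves both.\<close>

lemma level_eq_Nil_Suc:
  assumes "weval w = id"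
    and "\<And>x. \<exists>n. level_eq n (wsec w x) []"
  shows "\<exists>n. level_eq n w []"
proof -
  obtain n where n: "\<And>x. level_eq (n x) (wsec w x) []" using assms(2) by metis
  have "level_eq (max (n False) (n True)) (wsec w x) []" for x
    using level_eq_mono[OF n[of x]] by (cases x) auto
  then have "level_eq (Suc (max (n False) (n True))) w []"
    using weval_id_wsec[OF assms(1)] by simp
  then show ?thesis by blast
qed

text \<open>A word that is not reduced loses a cancelling pair; a reduced one passes to its
  sections. The induction hypothesis is a premise so that the step also applies to a section of the
  word under induction.\<close>

lemma contraction_step:
  assumes IH: "\<And>v. length v < length w \<Longrightarrow> weval v = id \<Longrightarrow> \<exists>n. level_eq n v []"
    and w: "weval w = id"
    and short: "reduced w \<Longrightarrow> (\<And>x. length (wsec w x) < length w)"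
  shows "\<exists>n. level_eq n w []"
proof (cases "reduced w")
  case True
  then show ?thesis
    by (intro level_eq_Nil_Suc[OF w] IH short weval_id_wsec[OF w])
next
  case False
  then obtain u l v where red: "w = u @ [l, letter_inv l] @ v" unfolding reduced_def by blast
  have "weval w = weval (u @ v)"
    unfolding red fun_eq_iff weval_append weval_cancel by simp
  then obtain n where "level_eq n (u @ v) []" using IH[of "u @ v"] w red by auto
  then show ?thesis
    using fequiv_level_eq[OF fequiv_cancel] level_eq_trans unfolding red by blast
qed

text \<open>Induction on the length. If one section keeps the full length, the other is empty by
  \<open>length_wsec_sum\<close>, and the long one is treated one level deeper with
  \<open>wsec_full_twice\<close>.\<close>

theorem contraction: "weval w = id \<Longrightarrow> \<exists>n. level_eq n w []"
proof (induction w rule: length_induct)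
  case (1 w)
  then have IH: "\<exists>n. level_eq n v []" if "length v < length w" "weval v = id" for v
    using that by blast
  note w = weval_id_wsec[OF "1.prems"]
  show ?case
  proof (cases "\<exists>x. w \<noteq> [] \<and> reduced w \<and> length (wsec w x) = length w")
    case True
    then obtain x where x: "w \<noteq> []" "reduced w" "length (wsec w x) = length w" by blast
    have 1: "\<exists>n. level_eq n (wsec w x) []"
    proof (rule contraction_step[OF _ w(2)])
      show "length (wsec (wsec w x) y) < length (wsec w x)" if "reduced (wsec w x)" for y
        using wsec_full_twice[OF x w(1) that weval_id_wsec(1)[OF w(2)]] x(3) by simp
    qed (use IH x in simp)
    have 2: "\<exists>n. level_eq n (wsec w (\<not> x)) []"
      using length_wsec_sum[of w] x by (intro IH w) (cases x; simp)
    show ?thesis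
    proof (rule level_eq_Nil_Suc[OF "1.prems"])
      show "\<exists>n. level_eq n (wsec w y) []" for y
        using 1 2 by (cases "y = x") auto
    qed
  next
    case False
    show ?thesis
    proof (cases "w = []")
      case True
      then show ?thesis by auto
    next
      case nonempty: False
      show ?thesis
      proof (rule contraction_step[OF IH "1.prems"])
        show "length (wsec w x) < length w" if "reduced w" for x
          using False nonempty that length_wsec[of w x] by (meson le_neq_implies_less)
      qed
    qed
  qed
qed

section \<open>Finitely presented covers\<close>

lemma level_stabilizer_onto:
  "\<exists>w. weval w (replicate n False) = replicate n False \<and> wsecs w (replicate n False) = v"
proof (induction n arbitrary: v)
  case (Suc n)
  obtain u where u: "weval u (replicate n False) = replicate n False"
      "wsecs u (replicate n False) = v"
    using Suc by blast
  \<comment> \<open>Lifts \<open>u\<close> through one level, letter by letter: \<open>b\<close>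
    replaces \<open>a\<close> and the square of \<open>a\<close> replaces \<open>b\<close>, with
    signs kept. Each replacement fixes 0.\<close>
  have "\<exists>w. \<not> wperm w False \<and> wsec w False = u"
  proof (induction u)
    case Nil
    show ?case by (rule exI[of _ "[]"]) simp
  next
    case (Cons l u)
    then obtain w where w: "\<not> wperm w False" "wsec w False = u" by blast
    obtain g s where l: "l = (g, s)" by (cases l)
    show ?case
    proof (cases g)
      case Ga
      then show ?thesis using w l by (intro exI[of _ "(Gb, s) # w"]) simp
    next
      case Gb
      then show ?thesis using w l by (intro exI[of _ "(Ga, s) # (Ga, s) # w"]) auto
    qed
  qed
  then obtain w where "\<not> wperm w False" "wsec w False = u" by blast
  then show ?case using u by (intro exI[of _ w]) simp
qed simp

text \<open>Finiteness gives a common level, the maximum of those provided by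
  \<open>contraction\<close>.\<close>

lemma level_eq_finite:
  assumes "finite W" "\<And>w. w \<in> W \<Longrightarrow> weval w = id"
  shows "\<exists>n. \<forall>w\<in>W. level_eq n w []"
  using assms
proof (induction W)
  case (insert w W)
  then obtain n m where "\<forall>w\<in>W. level_eq n w []" "level_eq m w []"
    using contraction by blast
  then have "\<forall>v\<in>insert w W. level_eq (max n m) v []"
    using level_eq_mono by (metis insertE max.cobounded1 max.cobounded2)
  then show ?case by blast
qed simp

text \<open>Replaces the isomorphism by an evaluation \<open>p\<close> of words in \<open>G\<close>,
  so that later arguments handle words instead of classes modulo \<open>R\<close>.\<close>

lemma finitely_presented_words:
  assumes "group G" "finitely_presented G"
  obtains A :: "nat set" and R p where "finite A" "finite R" "R \<subseteq> lists (A \<times> UNIV)"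
    and "p ` lists (A \<times> UNIV) = carrier G"
    and "\<And>u v. u \<in> lists (A \<times> UNIV) \<Longrightarrow> v \<in> lists (A \<times> UNIV) \<Longrightarrow> p (u @ v) = p u \<otimes>\<^bsub>G\<^esub> p v"
    and "\<And>u v. u \<in> lists (A \<times> UNIV) \<Longrightarrow> v \<in> lists (A \<times> UNIV) \<Longrightarrow> p u = p v \<longleftrightarrow> pequiv A R u v"
proof -
  interpret group G by fact
  obtain A :: "nat set" and R \<phi> where A: "finite A" "finite R" "R \<subseteq> lists (A \<times> UNIV)"
    and \<phi>: "\<phi> \<in> iso G (pres_group A R)"
    using assms(2) unfolding finitely_presented_def is_iso_def by blast
  let ?L = "lists (A \<times> (UNIV :: bool set))"
  \<comment> \<open>The class map followed by the inverse of the isomorphism.\<close>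
  define p where "p w = inv_into (carrier G) \<phi> (pclass A R w)" for w
  have bij: "bij_betw \<phi> (carrier G) (pclass A R ` ?L)" and hom: "\<phi> \<in> hom G (pres_group A R)"
    using \<phi> by (auto simp: iso_def pres_group_carrier)
  have p: "p w \<in> carrier G" "\<phi> (p w) = pclass A R w" if "w \<in> ?L" for w
    using that bij by (auto simp: p_def bij_betw_def f_inv_into_f inv_into_into)
  have p_eq: "p w = g" if "w \<in> ?L" "g \<in> carrier G" "\<phi> g = pclass A R w" for w g
    using p[OF that(1)] that bij by (auto simp: bij_betw_def inj_on_def)
  show thesis
  proof (rule that[OF A])
    have "g \<in> p ` ?L" if "g \<in> carrier G" for g
    proof -
      have "\<phi> g \<in> pclass A R ` ?L" using bij that by (auto simp: bij_betw_def)
      then show ?thesis using p_eq[OF _ that] by blast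
    qed
    then show "p ` ?L = carrier G" using p by auto
  next
    fix u v assume uv: "u \<in> ?L" "v \<in> ?L"
    show "p (u @ v) = p u \<otimes>\<^bsub>G\<^esub> p v"
      using uv p pres_group_mult[OF uv] by (intro p_eq) (auto simp: hom_mult[OF hom])
    show "p u = p v \<longleftrightarrow> pequiv A R u v"
      using uv p by (metis p_def pclass_eqD pclass_eqI)
  qed
qed

text \<open>Orbit-stabilizer argument. A right coset of the stabilizer is determined by where the
  inverse of a representative sends \<open>x\<close>.\<close>

lemma finite_rcosets_stabilizer:
  fixes G (structure)
  assumes "group G"
    and act: "\<And>g g'. g \<in> carrier G \<Longrightarrow> g' \<in> carrier G \<Longrightarrow> k (g \<otimes>\<^bsub>G\<^esub> g') = k g \<circ> k g'"
    and one: "k \<one>\<^bsub>G\<^esub> = id"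
    and fin: "finite ((\<lambda>g. k g x) ` carrier G)"
  shows "subgroup {g \<in> carrier G. k g x = x} G"
    and "finite (rcosets\<^bsub>G\<^esub> {g \<in> carrier G. k g x = x})"
proof -
  interpret group G by fact
  let ?H = "{g \<in> carrier G. k g x = x}"
  have inv1: "k (inv g) (k g y) = y" "k g (k (inv g) y) = y" if "g \<in> carrier G" for g y
    using act[of "inv g" g] act[of g "inv g"] that one by (auto simp: fun_eq_iff)
  show H: "subgroup ?H G"
  proof (rule subgroupI)
    show "?H \<noteq> {}" using one by auto
    show "inv g \<in> ?H" if "g \<in> ?H" for g
      using that inv1[of g x] by auto
  qed (auto simp: act)
  have coset: "?H #> g = ?H #> g'"
    if "g \<in> carrier G" "g' \<in> carrier G" "k (inv g) x = k (inv g') x" for g g'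
  proof -
    have "g' \<otimes> inv g \<in> ?H" using that inv1(2)[of g' x] by (auto simp: act)
    moreover have "g' = (g' \<otimes> inv g) \<otimes> g" using that by (simp add: m_assoc)
    ultimately have "g' \<in> ?H #> g" unfolding r_coset_def by blast
    then show ?thesis using repr_independence[OF _ that(1) H] by blast
  qed
  \<comment> \<open>Each coset is recovered from a point of the finite orbit by choosing a group
    element for that point.\<close>
  have "rcosets ?H \<subseteq> (\<lambda>y. ?H #> (SOME g. g \<in> carrier G \<and> k (inv g) x = y)) ` (\<lambda>g. k g x) ` carrier G"
  proof
    fix C assume "C \<in> rcosets ?H"
    then obtain g where g: "g \<in> carrier G" "C = ?H #> g" by (auto simp: RCOSETS_def)
    let ?g = "SOME g'. g' \<in> carrier G \<and> k (inv g') x = k (inv g) x"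
    have "?g \<in> carrier G \<and> k (inv ?g) x = k (inv g) x"
      by (rule someI[of _ g]) (use g in simp)
    then have "C = ?H #> ?g" unfolding g(2) by (intro coset) (simp_all add: g(1))
    then show "C \<in> (\<lambda>y. ?H #> (SOME g. g \<in> carrier G \<and> k (inv g) x = y)) ` (\<lambda>g. k g x) ` carrier G"
      by (intro image_eqI[of _ _ "k (inv g) x"] image_eqI[of _ _ "inv g"]) (simp_all add: g(1))
  qed
  then show "finite (rcosets ?H)" using fin finite_surj by blast
qed

theorem theorem1p8:
  fixes G :: "('g, 'm) monoid_scheme"
    and h :: "'g \<Rightarrow> (bool list \<Rightarrow> bool list)"
  assumes "group G"
    and "finitely_presented G"
    and "h \<in> hom G basilica"
    and "h ` carrier G = carrier basilica"
  shows "large G"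
proof -
  interpret group G by fact
  obtain A :: "nat set" and R p where A: "finite A" "finite R" "R \<subseteq> lists (A \<times> UNIV)"
    and p_onto: "p ` lists (A \<times> UNIV) = carrier G"
    and p_app: "\<And>u v. u \<in> lists (A \<times> UNIV) \<Longrightarrow> v \<in> lists (A \<times> UNIV) \<Longrightarrow> p (u @ v) = p u \<otimes>\<^bsub>G\<^esub> p v"
    and p_eq: "\<And>u v. u \<in> lists (A \<times> UNIV) \<Longrightarrow> v \<in> lists (A \<times> UNIV) \<Longrightarrow> p u = p v \<longleftrightarrow> pequiv A R u v"
    using finitely_presented_words[OF assms(1,2)] by metis
  let ?L = "lists (A \<times> (UNIV :: bool set))"
  have p_car: "p w \<in> carrier G" if "w \<in> ?L" for w using p_onto that by blast
  have p_Nil: "p [] = \<one>\<^bsub>G\<^esub>"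
    using p_app[of "[]" "[]"] p_car[of "[]"] by (simp add: r_cancel_one')
  have h_range: "h g \<in> range weval" if "g \<in> carrier G" for g
    using assms(4) that carrier_basilica by blast
  have h_mult: "h (g \<otimes>\<^bsub>G\<^esub> g') = h g \<circ> h g'" if "g \<in> carrier G" "g' \<in> carrier G" for g g'
    using hom_mult[OF assms(3) that] basilica_mult h_range that by simp
  have h_one: "h \<one>\<^bsub>G\<^esub> = id"
  \<comment> \<open>A preimage \<open>g\<close> of the identity map is used in place of a group
    structure on \<open>basilica\<close>.\<close>
  proof -
    obtain g where g: "g \<in> carrier G" "h g = id"
      using assms(4) carrier_basilica weval_Nil by (metis imageE rangeI)
    then show ?thesis using h_mult[of g "\<one>\<^bsub>G\<^esub>"] by simp
  qed

  \<comment> \<open>Lifting the generators of the cover to words in \<open>a\<close> and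
    \<open>b\<close>\<close>
  have "\<exists>t. weval t = h (p [l])" if "[l] \<in> ?L" for l
    using h_range[OF p_car[OF that]] by (metis imageE)
  \<comment> \<open>A generator and its inverse are lifted independently, so \<open>\<theta>\<close>
    need not respect free cancellation.\<close>
  then obtain t where t: "\<And>l. [l] \<in> ?L \<Longrightarrow> weval (t l) = h (p [l])" by metis
  define \<theta> where "\<theta> w = concat (map t w)" for w
  have \<theta>_app: "\<theta> (u @ v) = \<theta> u @ \<theta> v" for u v by (simp add: \<theta>_def)
  have eval_\<theta>: "weval (\<theta> w) = h (p w)" if "w \<in> ?L" for w
    using that
  proof (induction w)
    case Nil
    show ?case by (simp add: \<theta>_def p_Nil h_one)
  next
    case (Cons l w)
    then have "[l] \<in> ?L" by simp
    moreover have "weval (\<theta> (l # w)) = weval (t l) \<circ> weval (\<theta> w)"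
      by (simp add: \<theta>_def fun_eq_iff weval_append)
    ultimately show ?case
      using Cons t p_app[of "[l]" w] p_car h_mult by simp
  qed
  have \<theta>_trivial: "weval (\<theta> w) = id" if "w \<in> ?L" "pequiv A R [] w" for w
  proof -
    have "p w = p []" using p_eq[of "[]" w] that by simp
    then show ?thesis using eval_\<theta>[OF that(1)] p_Nil h_one by simp
  qed
  have "\<exists>w. w \<in> ?L \<and> h (p w) = weval [l]" for l
    using assms(4) carrier_basilica p_onto by (metis (no_types, lifting) imageE rangeI)
  then obtain s where s: "\<And>l. s l \<in> ?L" "\<And>l. h (p (s l)) = weval [l]" by metis

  \<comment> \<open>At a level where these words are trivial, \<open>\<theta>\<close> respects
    relators, respects cancelling pairs, and reaches the letters over \<open>a\<close> and
    \<open>b\<close>, in this order.\<close>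
  define W where "W = \<theta> ` R \<union> (\<lambda>l. \<theta> [l, letter_inv l]) ` (A \<times> UNIV)
    \<union> (\<lambda>l. \<theta> (s l) @ [letter_inv l]) ` ({Ga, Gb} \<times> UNIV)"
  have "finite W" using A by (auto simp: W_def)
  moreover have "weval w = id" if "w \<in> W" for w
    using that unfolding W_def
  proof (elim UnE imageE)
    fix r assume r: "w = \<theta> r" "r \<in> R"
    then have "pequiv A R [] r" using pstep_pequiv[OF pstep.relator[of r R A "[]" "[]"]] by simp
    then show ?thesis using r A(3) \<theta>_trivial by blast
  next
    fix l assume l: "w = \<theta> [l, letter_inv l]" "l \<in> A \<times> (UNIV :: bool set)"
    then have L: "[l, letter_inv l] \<in> ?L" by (auto simp: letter_inv_def)
    have "pequiv A R [] [l, letter_inv l]"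
      using pstep_pequiv[OF pstep.cancel[of l A R "[]" "[]"]] l by auto
    then show ?thesis using l(1) \<theta>_trivial[OF L] by blast
  next
    fix l assume l: "w = \<theta> (s l) @ [letter_inv l]"
    have "weval w = weval [l, letter_inv l]"
      unfolding l fun_eq_iff weval_append eval_\<theta>[OF s(1)] s(2) weval_Cons[of l "[letter_inv l]"] by simp
    then show ?thesis using weval_cancel[of l] by simp
  qed
  ultimately have "\<exists>n. \<forall>w\<in>W. level_eq n w []" by (rule level_eq_finite)
  then obtain n where n: "\<And>w. w \<in> W \<Longrightarrow> level_eq n w []" by blast

  \<comment> \<open>The induced epimorphism from \<open>G\<close> onto
    \<open>F / K\<^sub>n\<close>\<close>
  have \<theta>_level: "level_eq n (\<theta> u) (\<theta> v)" if "pequiv A R u v" for u v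
    using that
  proof (rule pequiv_mapI[where F = \<theta>])
    fix u v assume "pstep A R u v"
    then show "level_eq n (\<theta> u) (\<theta> v)"
    proof cases
      case (cancel l x y)
      then have "level_eq n (\<theta> [l, letter_inv l]) []" by (intro n) (auto simp: W_def mem_Times_iff)
      then show ?thesis unfolding cancel \<theta>_app
        using level_eq_append[of n _ _ _ "\<theta> y", OF _ level_eq_refl]
          level_eq_append[OF level_eq_refl, of n _ _ "\<theta> x"] level_eq_sym
        by (metis append_Nil)
    next
      case (relator r x y)
      then have "level_eq n (\<theta> r) []" by (intro n) (auto simp: W_def)
      then show ?thesis unfolding relator \<theta>_app
        using level_eq_append[of n _ _ _ "\<theta> y", OF _ level_eq_refl]
          level_eq_append[OF level_eq_refl, of n _ _ "\<theta> x"] level_eq_sym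
        by (metis append_Nil)
    qed
  qed (auto intro: level_eq_sym level_eq_trans)
  have lift: "\<exists>w \<in> ?L. level_eq n (\<theta> w) v" for v
  proof (induction v)
    case Nil
    then show ?case by (intro bexI[of _ "[]"]) (auto simp: \<theta>_def)
  next
    case (Cons l v)
    then obtain w where w: "w \<in> ?L" "level_eq n (\<theta> w) v" by blast
    have "fst l \<in> {Ga, Gb}" by (cases "fst l") auto
    then have "level_eq n (\<theta> (s l)) [l]"
      by (intro level_eq_cancel_right n) (auto simp: W_def mem_Times_iff)
    then have "level_eq n (\<theta> (s l @ w)) (l # v)"
      using level_eq_append[OF _ w(2), of "\<theta> (s l)" "[l]"] by (simp add: \<theta>_app)
    moreover have "s l @ w \<in> ?L" using s(1) w(1) by simp
    ultimately show ?case by blast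
  qed

  \<comment> \<open>The stabilizer of a vertex of level \<open>n\<close>\<close>
  define z where "z = replicate n False"
  have len_z: "length z = n" by (simp add: z_def)
  define H where "H = {g \<in> carrier G. h g z = z}"
  have fin: "finite ((\<lambda>g. h g z) ` carrier G)"
  proof (rule finite_subset)
    show "(\<lambda>g. h g z) ` carrier G \<subseteq> {y. set y \<subseteq> UNIV \<and> length y = n}"
      using h_range len_z by (force simp: image_iff)
    show "finite {y :: bool list. set y \<subseteq> UNIV \<and> length y = n}"
      by (rule finite_lists_length_eq) simp
  qed
  have H: "subgroup H G" "finite (rcosets\<^bsub>G\<^esub> H)"
    unfolding H_def
    by (rule finite_rcosets_stabilizer[where k = h and x = z], fact assms(1), erule (1) h_mult,
        fact h_one, fact fin)+

  \<comment> \<open>The section at \<open>z\<close> as an epimorphism onto a free group of rank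
    two\<close>
  define rep where "rep g = (SOME w. w \<in> ?L \<and> p w = g)" for g
  have rep: "rep g \<in> ?L" "p (rep g) = g" if "g \<in> carrier G" for g
  proof -
    have "g \<in> p ` ?L" using p_onto that by simp
    then have "\<exists>w. w \<in> ?L \<and> p w = g" by auto
    then have "rep g \<in> ?L \<and> p (rep g) = g" unfolding rep_def by (rule someI_ex)
    then show "rep g \<in> ?L" "p (rep g) = g" by auto
  qed
  let ?B = "{0, 1 :: nat}"
  let ?LB = "lists (?B \<times> (UNIV :: bool set))"
  define c :: "bgen \<Rightarrow> nat" where "c = case_bgen 0 1"
  have c: "range c \<subseteq> ?B" by (auto simp: c_def split: bgen.splits)
  have cL: "map (apfst c) w \<in> ?LB" for w :: bword
    by (induction w) (auto simp: c_def split: bgen.splits)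
  define f where "f g = pclass ?B {} (map (apfst c) (wsecs (\<theta> (rep g)) z))" for g
  \<comment> \<open>Congruence modulo \<open>K\<^sub>n\<close> determines the section at
    \<open>z\<close> in \<open>F\<close>, so the choice in \<open>rep\<close> does not matter and
    any congruent word \<open>v\<close> computes \<open>f\<close>.\<close>
  have f_eqI: "f (p w) = pclass ?B {} (map (apfst c) (wsecs v z))"
    if "w \<in> ?L" "level_eq n (\<theta> w) v" for w v
  proof -
    have "pequiv A R (rep (p w)) w" using p_eq rep p_car that(1) by blast
    then have "level_eq n (\<theta> (rep (p w))) v" using \<theta>_level level_eq_trans that(2) by blast
    then show ?thesis unfolding f_def
      by (intro pclass_eqI pequiv_map_generators[OF level_eq_wsecs c]) (simp add: len_z)
  qed
  have f_hom: "f \<in> hom (G\<lparr>carrier := H\<rparr>) (free_group ?B)"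
  proof (rule homI)
    fix g assume "g \<in> carrier (G\<lparr>carrier := H\<rparr>)"
    then show "f g \<in> carrier (free_group ?B)"
      unfolding f_def free_group_def pres_group_carrier using cL by blast
  next
    fix g g' assume "g \<in> carrier (G\<lparr>carrier := H\<rparr>)" "g' \<in> carrier (G\<lparr>carrier := H\<rparr>)"
    then have g: "g \<in> carrier G" "g' \<in> carrier G" "h g' z = z" by (auto simp: H_def)
    let ?u = "rep g" and ?v = "rep g'"
    have uv: "?u \<in> ?L" "?v \<in> ?L" "p (?u @ ?v) = g \<otimes>\<^bsub>G\<^esub> g'"
      using rep g p_app by auto
    \<comment> \<open>\<open>\<theta> ?v\<close> acts first and fixes \<open>z\<close>, so both
      factors of the product have their sections taken at \<open>z\<close>.\<close>
    have "weval (\<theta> ?v) z = z" using eval_\<theta>[of ?v] rep g by simp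
    then have sec: "wsecs (\<theta> (?u @ ?v)) z = wsecs (\<theta> ?u) z @ wsecs (\<theta> ?v) z"
      by (simp add: \<theta>_app wsecs_append)
    have "f (g \<otimes>\<^bsub>G\<^esub> g') = pclass ?B {} (map (apfst c) (wsecs (\<theta> (?u @ ?v)) z))"
      using f_eqI[of "?u @ ?v"] uv by simp
    also have "\<dots> = f g \<otimes>\<^bsub>free_group ?B\<^esub> f g'"
      unfolding f_def free_group_def pres_group_mult[OF cL cL] sec by simp
    finally show "f (g \<otimes>\<^bsub>G\<lparr>carrier := H\<rparr>\<^esub> g') = f g \<otimes>\<^bsub>free_group ?B\<^esub> f g'" by simp
  qed
  have f_onto: "f ` H = carrier (free_group ?B)"
  proof
    show "f ` H \<subseteq> carrier (free_group ?B)"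
      unfolding f_def free_group_def pres_group_carrier using cL by blast
    show "carrier (free_group ?B) \<subseteq> f ` H"
    proof
      fix C assume "C \<in> carrier (free_group ?B)"
      then obtain w where w: "w \<in> ?LB" "C = pclass ?B {} w"
        unfolding free_group_def pres_group_carrier by blast
      let ?d = "\<lambda>i :: nat. if i = 0 then Ga else Gb"
      have "map (apfst c) (map (apfst ?d) w) = w"
        using w(1) by (induction w) (auto simp: c_def)
      then obtain v where v: "w = map (apfst c) v" by metis
      \<comment> \<open>First lift \<open>v\<close> to a word in \<open>a\<close> and
        \<open>b\<close> that fixes \<open>z\<close>, then lift that word to one over
        \<open>A\<close>; the congruence keeps both the action on \<open>z\<close> and the section
        there.\<close>
      obtain v' where v': "weval v' z = z" "wsecs v' z = v"
        using level_stabilizer_onto unfolding z_def by blast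
      obtain u where u: "u \<in> ?L" "level_eq n (\<theta> u) v'" using lift by blast
      have "h (p u) z = z"
        using level_eq_weval[of z "\<theta> u" v'] u v' eval_\<theta> len_z by simp
      then have "p u \<in> H" using p_car u by (simp add: H_def)
      moreover have "f (p u) = C" using f_eqI[OF u] v v' w by simp
      ultimately show "C \<in> f ` H" by blast
    qed
  qed
  have "\<exists>x\<in>?B. \<exists>y\<in>?B. x \<noteq> y" by auto
  then show ?thesis unfolding large_def
    by (intro exI[of _ H] exI[of _ ?B] exI[of _ f] conjI H f_hom f_onto)
qed

end
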